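(* Let $n, p \geq 1$ be integers and let $\{(\mathbf{x}_i, y_i) : i = 1, \ldots, n\} \subseteq [0,1]^p \times \mathbb{R}$ be any sample such that $\mathbf{x}_i \neq \mathbf{x}_j$ for all $1 \leq i \neq j \leq n$. Then there exists a (multivariate) DC function $f : [0,1]^p \to \mathbb{R}$ such that $f(\mathbf{x}_i) = y_i$ for all $i = 1, \ldots, n$.
   Context: A function $f : [0,1]^p \to \mathbb{R}$ is called DC (difference of convex) if there exist convex functions $g, h : [0,1]^p \to \mathbb{R}$ such that $f = g - h$ on $[0,1]^p$. *)

theory Defs
  imports "HOL-Analysis.Analysis"
begin

text \<open>The cube \<open>[0,1]\<^sup>p\<close> in \<open>\<real>\<^sup>p\<close>, where \<open>p = CARD('p)\<close>; here \<open>p \<ge> 1\<close> holds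
  automatically because types are nonempty.\<close>

definition unit_cube :: "(real ^ 'p::finite) set" where
  "unit_cube = {x. \<forall>j. 0 \<le> x $ j \<and> x $ j \<le> 1}"

text \<open>Functions on \<open>S\<close> are rendered as total functions of which only the values on \<open>S\<close> matter.
  The library's \<^const>\<open>convex_on\<close> also requires \<open>S\<close> itself to be convex.\<close>

definition dc_on :: "'a::real_vector set \<Rightarrow> ('a \<Rightarrow> real) \<Rightarrow> bool" where
  "dc_on S f \<longleftrightarrow> (\<exists>g h. convex_on S g \<and> convex_on S h \<and> (\<forall>x\<in>S. f x = g x - h x))"

end

theory Submission
  imports Defs
begin

text \<open>Around each sample point \<open>a\<close> put the tent \<open>max 0 (1 - dist a z / \<delta>)\<close>, with \<open>\<delta>\<close> so small that
  it vanishes at the other sample points. The tent equals \<open>max 1 (dist a z / \<delta>) - dist a z / \<delta>\<close>,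
  a difference of convex functions, and linear combinations of DC functions are DC.\<close>

lemma convex_unit_cube: "convex (unit_cube :: (real ^ 'p::finite) set)"
proof -
  have "unit_cube = (cbox 0 1 :: (real ^ 'p) set)"
    by (auto simp: unit_cube_def mem_box_cart)
  then show ?thesis
    by (metis convex_box(1))
qed

text \<open>The value of each function at a convex combination is at most the combination of its own
  endpoint values, and replacing these by the maxima only enlarges the bound.\<close>

lemma convex_on_max:
  fixes f g :: "'a::real_vector \<Rightarrow> real"
  assumes "convex_on S f" "convex_on S g"
  shows "convex_on S (\<lambda>x. max (f x) (g x))"
proof (rule convex_onI)
  show "convex S"
    using assms(1) by (rule convex_on_imp_convex)
  fix t :: real and x y
  assume t: "0 < t" "t < 1" and xy: "x \<in> S" "y \<in> S"
  \<comment> \<open>Stated for any convex \<open>h\<close> below the maximum, so that one argument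
    serves for both \<open>f\<close> and \<open>g\<close>.\<close>
  have "h ((1 - t) *\<^sub>R x + t *\<^sub>R y) \<le> (1 - t) * max (f x) (g x) + t * max (f y) (g y)"
    if "convex_on S h" "\<And>z. h z \<le> max (f z) (g z)" for h
  proof -
    have "h ((1 - t) *\<^sub>R x + t *\<^sub>R y) \<le> (1 - t) * h x + t * h y"
      using convex_onD[OF that(1), of t x y] t xy by simp
    also have "\<dots> \<le> (1 - t) * max (f x) (g x) + t * max (f y) (g y)"
      using t that(2) by (intro add_mono mult_left_mono) auto
    finally show ?thesis .
  qed
  from this[OF assms(1)] this[OF assms(2)]
  show "max (f ((1 - t) *\<^sub>R x + t *\<^sub>R y)) (g ((1 - t) *\<^sub>R x + t *\<^sub>R y))
      \<le> (1 - t) * max (f x) (g x) + t * max (f y) (g y)"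
    by simp
qed

lemma dc_on_add:
  assumes "dc_on S f" "dc_on S f'"
  shows "dc_on S (\<lambda>x. f x + f' x)"
proof -
  from assms obtain g h g' h' where "convex_on S g" "convex_on S h" "\<forall>x\<in>S. f x = g x - h x"
    "convex_on S g'" "convex_on S h'" "\<forall>x\<in>S. f' x = g' x - h' x"
    unfolding dc_on_def by blast
  then show ?thesis
    unfolding dc_on_def
    by (intro exI[of _ "\<lambda>x. g x + g' x"] exI[of _ "\<lambda>x. h x + h' x"]) (simp add: convex_on_add)
qed

lemma dc_on_cmult:
  assumes "dc_on S f"
  shows "dc_on S (\<lambda>x. c * f x)"
proof -
  from assms obtain g h where gh: "convex_on S g" "convex_on S h" "\<forall>x\<in>S. f x = g x - h x"
    unfolding dc_on_def by blast
  show ?thesis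
  proof (cases "c \<ge> 0")
    case True
    with gh show ?thesis
      unfolding dc_on_def
      by (intro exI[of _ "\<lambda>x. c * g x"] exI[of _ "\<lambda>x. c * h x"])
        (simp add: convex_on_cmul right_diff_distrib)
  next
    case False
    \<comment> \<open>A negative factor swaps the two convex parts:
      \<open>c * (g - h) = (- c) * h - (- c) * g\<close>, where \<open>- c\<close> is
      positive.\<close>
    then have "convex_on S (\<lambda>x. - c * h x)" "convex_on S (\<lambda>x. - c * g x)"
      using gh convex_on_cmul[of "- c" S] by simp_all
    with gh show ?thesis
      unfolding dc_on_def
      by (intro exI[of _ "\<lambda>x. - c * h x"] exI[of _ "\<lambda>x. - c * g x"])
        (simp add: right_diff_distrib)
  qed
qed

lemma dc_on_sum:
  assumes "convex S" "\<And>i. i \<in> I \<Longrightarrow> dc_on S (f i)"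
  shows "dc_on S (\<lambda>x. \<Sum>i\<in>I. f i x)"
proof -
  \<comment> \<open>The zero function settles both the empty and the infinite index set, since a sum
    over an infinite set is 0 by convention. Constants are convex on \<open>S\<close> only because
    \<open>S\<close> is convex.\<close>
  have zero: "dc_on S (\<lambda>x. 0)"
    unfolding dc_on_def
    by (intro exI[of _ "\<lambda>x. 0"]) (simp add: assms(1) convex_on_const)
  from assms(2) show ?thesis
    by (induction I rule: infinite_finite_induct) (simp_all add: zero dc_on_add)
qed

lemma dc_on_tent:
  fixes a :: "'a::real_normed_vector"
  assumes "convex S" "d > 0"
  shows "dc_on S (\<lambda>z. max 0 (1 - dist a z / d))"
proof -
  have "convex_on S (\<lambda>z. inverse d * dist a z)"
    using assms by (intro convex_on_cmul convex_on_dist) auto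
  then have "convex_on S (\<lambda>z. dist a z / d)"
    by (simp add: divide_inverse mult.commute)
  then show ?thesis
    unfolding dc_on_def using assms(1)
    by (intro exI[of _ "\<lambda>z. max 1 (dist a z / d)"] exI[of _ "\<lambda>z. dist a z / d"])
      (auto intro: convex_on_max simp: convex_on_const)
qed

text \<open>The tents act as a nodal basis at the sample points, so the values \<open>y i\<close>
  themselves are the right coefficients.\<close>

lemma dc_on_interpolation:
  fixes x :: "'i \<Rightarrow> 'a::real_normed_vector" and y :: "'i \<Rightarrow> real"
  assumes "convex S" "finite I" "inj_on x I"
  shows "\<exists>f. dc_on S f \<and> (\<forall>i\<in>I. f (x i) = y i)"
proof -
  \<comment> \<open>A finite set keeps a positive distance from each point once that point itself is
    excluded; this gives the tent radii.\<close>
  have "\<exists>d>0. \<forall>b\<in>x ` I. b \<noteq> x i \<longrightarrow> d \<le> dist (x i) b" for i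
    using finite_set_avoid[of "x ` I" "x i"] assms(2) by auto
  then obtain d where d: "\<And>i. d i > 0"
    "\<And>i b. b \<in> x ` I \<Longrightarrow> b \<noteq> x i \<Longrightarrow> d i \<le> dist (x i) b"
    by metis
  let ?f = "\<lambda>z. \<Sum>i\<in>I. y i * max 0 (1 - dist (x i) z / d i)"
  have "dc_on S ?f"
    using assms(1) d(1) by (intro dc_on_sum dc_on_cmult dc_on_tent)
  moreover have "?f (x j) = y j" if j: "j \<in> I" for j
  proof -
    \<comment> \<open>For \<open>i \<noteq> j\<close>, injectivity makes the two points distinct, so
      their distance is at least \<open>d i\<close> and the second argument of \<open>max\<close> is
      at most 0.\<close>
    have "max 0 (1 - dist (x i) (x j) / d i) = (if i = j then 1 else 0)" if "i \<in> I" for i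
    proof (cases "i = j")
      case False
      then have "x j \<noteq> x i"
        using j that assms(3) by (auto dest: inj_onD)
      then show ?thesis
        using False d(1)[of i] d(2)[of "x j" i] j by simp
    qed simp
    then have "?f (x j) = (\<Sum>i\<in>I. if i = j then y i else 0)"
      by (intro sum.cong) auto
    then show ?thesis
      using assms(2) j by simp
  qed
  ultimately show ?thesis
    by blast
qed

theorem theorem2:
  fixes n :: nat
    and x :: "nat \<Rightarrow> real ^ 'p::finite"
    and y :: "nat \<Rightarrow> real"
  assumes "n \<ge> 1"
    and "\<And>i. i \<in> {1..n} \<Longrightarrow> x i \<in> unit_cube"
    and "\<And>i j. i \<in> {1..n} \<Longrightarrow> j \<in> {1..n} \<Longrightarrow> i \<noteq> j \<Longrightarrow> x i \<noteq> x j"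
  shows "\<exists>f :: real ^ 'p \<Rightarrow> real. dc_on unit_cube f \<and> (\<forall>i\<in>{1..n}. f (x i) = y i)"
proof (rule dc_on_interpolation)
  show "inj_on x {1..n}"
    using assms(3) by (meson inj_onI)
qed (simp_all add: convex_unit_cube)

end
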